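(* Let $G=(V,E)$ be a connected locally finite weighted graph with symmetric positive edge weights $w_{xy}$ and vertex measure $\mu:V\to(0,\infty)$. Let $f,g:V\to\mathbb{R}$ be functions such that $g(x)\le f(x)<0$ for all $x\in V$ and $g\in L^1(V)$. Then the equation $$\Delta u=f-ge^u\quad\text{in } V$$ has a solution $u:V\to\mathbb{R}$.
   Context: $G=(V,E)$ is a connected graph with vertex set $V$ and edge set $E$; $y\sim x$ means $xy\in E$. Each edge $xy\in E$ has a weight $w_{xy}>0$ with $w_{xy}=w_{yx}$, and $\mu:V\to(0,\infty)$ is a measure on the vertices. The distance $\rho(x,O)$ between $x$ and $O$ is the number of edges of a shortest path joining them (and $\rho(O,O)=0$). The graph is locally finite if for every $O\in V$ and every integer $k\ge1$ the ball $B_k=\{x\in V:\rho(x,O)<k\}$ is finite. $L^1(V)$ is the space of functions $g:V\to\mathbb{R}$ with $\sum_{x\in V}\mu(x)|g(x)|<\infty$. The Laplacian is $\Delta u(x)=\frac{1}{\mu(x)}\sum_{y\sim x}w_{xy}(u(y)-u(x))$. The equation is understood pointwise at every $x\in V$. *)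

theory Defs
  imports Complex_Main "HOL-Analysis.Infinite_Sum"
begin

text \<open>
  Edges are unordered pairs of distinct vertices; \<open>V\<close> may be infinite.
  The weights are only constrained on edges and the measure only on \<open>V\<close>; their values
  elsewhere are never used.
\<close>

locale weighted_graph =
  fixes V :: "'a set" and E :: "'a set set" and w :: "'a \<Rightarrow> 'a \<Rightarrow> real" and \<mu> :: "'a \<Rightarrow> real"
  assumes edges: "E \<subseteq> {{x, y} | x y. x \<in> V \<and> y \<in> V \<and> x \<noteq> y}"
    and weight_pos: "{x, y} \<in> E \<Longrightarrow> w x y > 0"
    and weight_sym: "{x, y} \<in> E \<Longrightarrow> w x y = w y x"
    and measure_pos: "x \<in> V \<Longrightarrow> \<mu> x > 0"

text \<open>
  A path is given by the list of its successive vertices, so its number of edges is one less than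
  the length of the list. Repeated vertices are not excluded: a shortest path has none.
\<close>

definition path_joining :: "'a set \<Rightarrow> 'a set set \<Rightarrow> 'a \<Rightarrow> 'a \<Rightarrow> 'a list \<Rightarrow> bool" where
  "path_joining V E x y p \<longleftrightarrow>
     p \<noteq> [] \<and> hd p = x \<and> last p = y \<and> set p \<subseteq> V \<and> successively (\<lambda>a b. {a, b} \<in> E) p"

definition connected_graph :: "'a set \<Rightarrow> 'a set set \<Rightarrow> bool" where
  "connected_graph V E \<longleftrightarrow> (\<forall>x\<in>V. \<forall>y\<in>V. \<exists>p. path_joining V E x y p)"

text \<open>Meaningful only for vertices joined by some path, hence used for connected graphs.\<close>

definition graph_dist :: "'a set \<Rightarrow> 'a set set \<Rightarrow> 'a \<Rightarrow> 'a \<Rightarrow> nat" where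
  "graph_dist V E x y = (LEAST n. \<exists>p. path_joining V E x y p \<and> length p - 1 = n)"

definition graph_ball :: "'a set \<Rightarrow> 'a set set \<Rightarrow> 'a \<Rightarrow> nat \<Rightarrow> 'a set" where
  "graph_ball V E z k = {x \<in> V. graph_dist V E x z < k}"

definition locally_finite_graph :: "'a set \<Rightarrow> 'a set set \<Rightarrow> bool" where
  "locally_finite_graph V E \<longleftrightarrow> (\<forall>z\<in>V. \<forall>k\<ge>1. finite (graph_ball V E z k))"

definition L1 :: "'a set \<Rightarrow> ('a \<Rightarrow> real) \<Rightarrow> ('a \<Rightarrow> real) set" where
  "L1 V \<mu> = {g. (\<lambda>x. \<mu> x * \<bar>g x\<bar>) summable_on V}"

text \<open>In a locally finite connected graph the neighbourhood \<open>{y. {x, y} \<in> E}\<close> is finite.\<close>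

definition laplacian ::
    "'a set set \<Rightarrow> ('a \<Rightarrow> 'a \<Rightarrow> real) \<Rightarrow> ('a \<Rightarrow> real) \<Rightarrow> ('a \<Rightarrow> real) \<Rightarrow> 'a \<Rightarrow> real" where
  "laplacian E w \<mu> u x = 1 / \<mu> x * (\<Sum>y | {x, y} \<in> E. w x y * (u y - u x))"

end

theory Submission imports Defs begin

text \<open>
  With \<open>a = - \<mu> f\<close> and \<open>b = - \<mu> g\<close> the equation reads
  \<open>\<mu> \<Delta>u = b e\<^sup>u - a\<close>. The solution is the pointwise infimum of the finitely supported
  nonpositive supersolutions, a family that contains \<open>0\<close> because \<open>a \<le> b\<close>. By the symmetry of the
  weights, \<open>\<mu> \<Delta>v\<close> has nonnegative sum over any finite set containing the support of such a
  \<open>v\<close>, so \<open>\<Sum> a \<le> \<Sum> b e\<^sup>v\<close>. As \<open>b\<close> is summable and \<open>a > 0\<close>, this prevents the family from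
  being very negative on a whole finite set, and since it is closed under minima, the infimum is
  finite at some vertex. Solving the equation at a single vertex stays within the family, so
  finiteness spreads to the neighbours, hence to all of \<open>V\<close>, and the infimum solves the equation.
\<close>

section \<open>Tails of summable families and a scalar equation\<close>

text \<open>Choose \<open>A\<close> with partial sum within \<open>e\<close> of the total. A finite
  set disjoint from \<open>A\<close> then adds less than \<open>e\<close>, because no finite partial
  sum exceeds the total.\<close>

lemma summable_on_small_tail:
  fixes b :: "'a \<Rightarrow> real"
  assumes summ: "b summable_on V" and nonneg: "\<And>x. x \<in> V \<Longrightarrow> 0 \<le> b x" and "0 < e"
  obtains A where "finite A" "A \<subseteq> V" "\<And>B. finite B \<Longrightarrow> B \<subseteq> V - A \<Longrightarrow> sum b B < e"
proof -
  have "(sum b \<longlongrightarrow> infsum b V) (finite_subsets_at_top V)"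
    using has_sum_infsum[OF summ] by (simp add: has_sum_def)
  then have "\<forall>\<^sub>F A in finite_subsets_at_top V. infsum b V - e < sum b A"
    using \<open>0 < e\<close> by (intro order_tendstoD) auto
  then obtain A where A: "finite A" "A \<subseteq> V" "infsum b V - e < sum b A"
    unfolding eventually_finite_subsets_at_top by blast
  have "sum b B < e" if B: "finite B" "B \<subseteq> V - A" for B
  proof -
    have "sum b (A \<union> B) \<le> infsum b V"
      using A B nonneg by (intro finite_sum_le_infsum[OF summ]) auto
    moreover have "sum b (A \<union> B) = sum b A + sum b B"
      using A B by (intro sum.union_disjoint) auto
    ultimately show ?thesis
      using A by linarith
  qed
  with A show ?thesis
    using that by blast
qed

text \<open>This is the equation at one vertex with its neighbours' values held fixed: at
  \<open>s\<close> the left side is at least \<open>c\<close>, and the intermediate value theorem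
  gives a root below. For \<open>W = 0\<close>, an isolated vertex, the left side is always
  positive, hence the condition on \<open>c\<close>.\<close>

lemma solve_linear_plus_exp_below:
  fixes c W b s :: real
  assumes "0 \<le> W" "0 < b" "W = 0 \<Longrightarrow> 0 < c" "c \<le> W * s + b * exp s"
  obtains t where "t \<le> s" "W * t + b * exp t = c"
proof -
  obtain t0 where t0: "t0 \<le> s" "W * t0 + b * exp t0 \<le> c"
  proof (cases "W = 0")
    case True
    with assms have "0 < c" "c / b \<le> exp s"
      by (auto simp: field_simps)
    then have "ln (c / b) \<le> s"
      using \<open>0 < b\<close> ln_mono[of "c / b" "exp s"] by simp
    then show ?thesis
      using that[of "ln (c / b)"] True \<open>0 < b\<close> \<open>0 < c\<close> by simp
  next
    case False
    \<comment> \<open>The bound by \<open>0\<close> gives \<open>exp t0 \<le> 1\<close>, and the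
      bound by \<open>(c - b) / W\<close> leaves room for the resulting \<open>b\<close>.\<close>
    define t0 where "t0 = min (min s 0) ((c - b) / W)"
    have "W * t0 \<le> W * ((c - b) / W)"
      using \<open>0 \<le> W\<close> by (intro mult_left_mono) (auto simp: t0_def)
    moreover have "b * exp t0 \<le> b * 1"
      using \<open>0 < b\<close> by (intro mult_left_mono) (auto simp: t0_def)
    ultimately show ?thesis
      using that[of t0] False by (auto simp: t0_def)
  qed
  have "\<exists>t\<ge>t0. t \<le> s \<and> W * t + b * exp t = c"
    using t0 assms by (intro IVT') (auto intro!: continuous_intros)
  then show ?thesis
    using that by blast
qed

section \<open>Supersolutions and their closure properties\<close>

locale exponential_equation = weighted_graph V E w \<mu>
  for V :: "'a set" and E :: "'a set set" and w :: "'a \<Rightarrow> 'a \<Rightarrow> real" and \<mu> :: "'a \<Rightarrow> real" +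
  fixes a b :: "'a \<Rightarrow> real"
  assumes finite_nbhd: "x \<in> V \<Longrightarrow> finite {y. {x, y} \<in> E}"
    and connected: "connected_graph V E"
    and a_pos: "x \<in> V \<Longrightarrow> 0 < a x"
    and a_le_b: "x \<in> V \<Longrightarrow> a x \<le> b x"
    and b_summable: "b summable_on V"
begin

abbreviation nbhd :: "'a \<Rightarrow> 'a set" where
  "nbhd x \<equiv> {y. {x, y} \<in> E}"

text \<open>This is \<open>\<mu>\<close> times the Laplacian: without the factor
  \<open>1 / \<mu> x\<close>, the contributions of an edge at its two ends are opposite.\<close>

definition flow :: "('a \<Rightarrow> real) \<Rightarrow> 'a \<Rightarrow> real" where
  "flow v x = (\<Sum>y\<in>nbhd x. w x y * (v y - v x))"

text \<open>Finite support reduces the global sum of \<open>flow v\<close> to a finite one; the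
  bound \<open>v x \<le> 0\<close> fixes the sign of its boundary terms and gives
  \<open>exp (v x) \<le> 1\<close>.\<close>

definition supersolutions :: "('a \<Rightarrow> real) set" where
  "supersolutions = {v. (\<forall>x\<in>V. v x \<le> 0 \<and> flow v x \<le> b x * exp (v x) - a x)
     \<and> finite {x \<in> V. v x \<noteq> 0}}"

lemma supersolutions_nonpos: "v \<in> supersolutions \<Longrightarrow> x \<in> V \<Longrightarrow> v x \<le> 0"
  and supersolutions_flow:
    "v \<in> supersolutions \<Longrightarrow> x \<in> V \<Longrightarrow> flow v x \<le> b x * exp (v x) - a x"
  and supersolutions_finite_support: "v \<in> supersolutions \<Longrightarrow> finite {x \<in> V. v x \<noteq> 0}"
  by (auto simp: supersolutions_def)

lemma b_pos: "x \<in> V \<Longrightarrow> 0 < b x"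
  using a_pos a_le_b by force

lemma edgeD: "{x, y} \<in> E \<Longrightarrow> x \<in> V \<and> y \<in> V \<and> x \<noteq> y"
  using edges by (force simp: doubleton_eq_iff)

lemma flow_eq:
  "flow v x = (\<Sum>y\<in>nbhd x. w x y * v y) - sum (w x) (nbhd x) * v x"
  by (simp add: flow_def right_diff_distrib sum_subtractf sum_distrib_right)

lemma flow_mono:
  assumes "\<And>y. y \<in> nbhd x \<Longrightarrow> v y \<le> v' y" "v x = v' x"
  shows "flow v x \<le> flow v' x"
  unfolding flow_def using assms weight_pos
  by (intro sum_mono mult_left_mono) (auto intro: less_imp_le)

lemma zero_supersolution: "(\<lambda>_. 0) \<in> supersolutions"
  using a_le_b by (simp add: supersolutions_def flow_def)

text \<open>At each vertex the minimum equals one of the two functions and lies below it at the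
  neighbours, so its flow there is no larger.\<close>

lemma min_supersolution:
  assumes "v \<in> supersolutions" "v' \<in> supersolutions"
  shows "(\<lambda>x. min (v x) (v' x)) \<in> supersolutions"
proof -
  let ?m = "\<lambda>x. min (v x) (v' x)"
  have "flow ?m x \<le> b x * exp (?m x) - a x" if "x \<in> V" for x
  proof (cases "v x \<le> v' x")
    case True
    have "flow ?m x \<le> flow v x"
      using True by (intro flow_mono) auto
    with supersolutions_flow[OF assms(1) that] True show ?thesis
      by simp
  next
    case False
    have "flow ?m x \<le> flow v' x"
      using False by (intro flow_mono) auto
    with supersolutions_flow[OF assms(2) that] False show ?thesis
      by simp
  qed
  moreover have "finite {x \<in> V. ?m x \<noteq> 0}"
  proof (rule finite_subset)
    show "{x \<in> V. ?m x \<noteq> 0} \<subseteq> {x \<in> V. v x \<noteq> 0} \<union> {x \<in> V. v' x \<noteq> 0}"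
      by auto
    show "finite ({x \<in> V. v x \<noteq> 0} \<union> {x \<in> V. v' x \<noteq> 0})"
      using assms[THEN supersolutions_finite_support] by simp
  qed
  ultimately show ?thesis
    using supersolutions_nonpos[OF assms(1)] by (simp add: supersolutions_def min_le_iff_disj)
qed

lemma common_lower_supersolution:
  assumes "finite A" "\<And>x. x \<in> A \<Longrightarrow> \<exists>v\<in>supersolutions. v x < c x"
  shows "\<exists>v\<in>supersolutions. \<forall>x\<in>A. v x < c x"
  using assms
proof (induction A)
  case empty
  then show ?case
    using zero_supersolution by blast
next
  case (insert z A)
  obtain v v' where "v \<in> supersolutions" "\<forall>x\<in>A. v x < c x" "v' \<in> supersolutions" "v' z < c z"
    using insert by blast
  then show ?case
    by (intro bexI[of _ "\<lambda>x. min (v x) (v' x)"] min_supersolution) (auto simp: min_less_iff_disj)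
qed

text \<open>Lowering the value at \<open>x\<close> until equality holds there can only decrease the
  flow at the other vertices, so their inequalities survive.\<close>

lemma update_supersolution:
  assumes v: "v \<in> supersolutions" and x: "x \<in> V"
  obtains t where "v(x := t) \<in> supersolutions"
    "sum (w x) (nbhd x) * t + b x * exp t = (\<Sum>y\<in>nbhd x. w x y * v y) + a x"
proof -
  let ?W = "sum (w x) (nbhd x)" and ?c = "(\<Sum>y\<in>nbhd x. w x y * v y) + a x"
  have "0 \<le> ?W"
    using weight_pos by (intro sum_nonneg) (auto intro: less_imp_le)
  moreover have "0 < ?c" if "?W = 0"
  proof -
    \<comment> \<open>Positive weights sum to zero only over an empty neighbourhood, which leaves
      \<open>?c = a x\<close>.\<close>
    have "nbhd x = {}"
      using that weight_pos finite_nbhd[OF x] sum_pos[of "nbhd x" "w x"] by fastforce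
    then show ?thesis
      using a_pos[OF x] by simp
  qed
  moreover have "?c \<le> ?W * v x + b x * exp (v x)"
    using supersolutions_flow[OF v x] by (simp add: flow_eq)
  ultimately obtain t where t: "t \<le> v x" "?W * t + b x * exp t = ?c"
    using solve_linear_plus_exp_below[of ?W "b x" ?c "v x"] b_pos[OF x] by blast
  let ?v = "v(x := t)"
  have "flow ?v z \<le> b z * exp (?v z) - a z" if z: "z \<in> V" for z
  proof (cases "z = x")
    case True
    have "(\<Sum>y\<in>nbhd x. w x y * ?v y) = (\<Sum>y\<in>nbhd x. w x y * v y)"
      by (intro sum.cong) (auto dest: edgeD)
    then show ?thesis
      using t True by (simp add: flow_eq)
  next
    case False
    then have "flow ?v z \<le> flow v z"
      using t by (intro flow_mono) auto
    then show ?thesis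
      using supersolutions_flow[OF v z] False by simp
  qed
  moreover have "finite {z \<in> V. ?v z \<noteq> 0}"
    using supersolutions_finite_support[OF v]
    by (rule finite_subset[rotated, OF finite.insertI[of _ x]]) auto
  moreover have "?v z \<le> 0" if "z \<in> V" for z
    using supersolutions_nonpos[OF v] that x t by force
  ultimately have "?v \<in> supersolutions"
    by (simp add: supersolutions_def)
  then show ?thesis
    using t that by blast
qed

section \<open>Finiteness of the infimum at some vertex\<close>

text \<open>Edges inside \<open>A\<close> cancel by symmetry, and those leaving \<open>A\<close> contribute \<open>- w x y * v x\<close>.\<close>

lemma sum_flow_nonneg:
  assumes A: "finite A" "A \<subseteq> V" and nonpos: "\<And>x. x \<in> V \<Longrightarrow> v x \<le> 0"
    and supp: "\<And>x. x \<in> V - A \<Longrightarrow> v x = 0"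
  shows "0 \<le> (\<Sum>x\<in>A. flow v x)"
proof -
  \<comment> \<open>Extended by zero off the edges, the terms allow both indices to run over
    \<open>A\<close>; swapping the indices then negates the double sum.\<close>
  let ?d = "\<lambda>x y. if {x, y} \<in> E then w x y * (v y - v x) else 0"
  have antisym: "?d x y = - ?d y x" for x y
    using weight_sym[of x y] by (auto simp: insert_commute algebra_simps)
  have "(\<Sum>x\<in>A. \<Sum>y\<in>A. ?d x y) = (\<Sum>x\<in>A. \<Sum>y\<in>A. ?d y x)"
    by (rule sum.swap)
  also have "\<dots> = - (\<Sum>x\<in>A. \<Sum>y\<in>A. ?d x y)"
    unfolding sum_negf[symmetric] by (intro sum.cong refl antisym)
  finally have "(\<Sum>x\<in>A. \<Sum>y\<in>A. ?d x y) = 0"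
    by linarith
  moreover have "(\<Sum>y\<in>A. ?d x y) \<le> flow v x" if x: "x \<in> A" for x
  proof -
    have "(\<Sum>y\<in>A. ?d x y) = (\<Sum>y\<in>nbhd x \<inter> A. w x y * (v y - v x))"
      using A by (intro sum.mono_neutral_cong_right) auto
    also have "\<dots> \<le> flow v x"
      unfolding flow_def
    proof (rule sum_mono2)
      show "finite (nbhd x)"
        using finite_nbhd x A by auto
      show "0 \<le> w x y * (v y - v x)" if "y \<in> nbhd x - nbhd x \<inter> A" for y
        using that weight_pos[of x y] supp[of y] nonpos[of x] edgeD[of x y]
        by (auto simp: mult_nonneg_nonpos)
    qed auto
    finally show ?thesis .
  qed
  then have "(\<Sum>x\<in>A. \<Sum>y\<in>A. ?d x y) \<le> (\<Sum>x\<in>A. flow v x)"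
    by (rule sum_mono)
  ultimately show ?thesis
    by simp
qed

lemma sum_a_le_sum_b_exp:
  assumes v: "v \<in> supersolutions" and A: "finite A" "A \<subseteq> V" "{x \<in> V. v x \<noteq> 0} \<subseteq> A"
  shows "sum a A \<le> (\<Sum>x\<in>A. b x * exp (v x))"
proof -
  have "0 \<le> (\<Sum>x\<in>A. flow v x)"
    using A supersolutions_nonpos[OF v] by (intro sum_flow_nonneg) auto
  also have "\<dots> \<le> (\<Sum>x\<in>A. b x * exp (v x) - a x)"
    using A supersolutions_flow[OF v] by (intro sum_mono) auto
  finally show ?thesis
    by (simp add: sum_subtractf)
qed

text \<open>Otherwise one supersolution lies below a very negative \<open>C\<close> on all of
  \<open>A\<close>. Then \<open>A\<close> and its complement each contribute less than
  \<open>a z / 2\<close> to the sum of \<open>b x * exp (v x)\<close>, which must be at least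
  \<open>a z\<close>.\<close>

lemma bdd_below_some:
  assumes "V \<noteq> {}"
  shows "\<exists>x\<in>V. bdd_below ((\<lambda>v. v x) ` supersolutions)"
proof (rule ccontr)
  assume unbdd: "\<not> ?thesis"
  obtain z where z: "z \<in> V"
    using assms by blast
  obtain A where A: "finite A" "A \<subseteq> V" "\<And>B. finite B \<Longrightarrow> B \<subseteq> V - A \<Longrightarrow> sum b B < a z / 2"
    using summable_on_small_tail[OF b_summable, of "a z / 2"] b_pos a_pos[OF z]
    by (metis half_gt_zero less_imp_le)
  have bA: "0 \<le> sum b A"
    using A(2) b_pos by (intro sum_nonneg) (auto intro: less_imp_le)
  \<comment> \<open>Adding \<open>1\<close> keeps the denominator positive for empty
    \<open>A\<close> and makes the next estimate strict.\<close>
  define C where "C = ln (a z / 2 / (sum b A + 1))"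
  have C: "sum b A * exp C < a z / 2"
    using bA a_pos[OF z] by (simp add: C_def field_simps)
  have "\<exists>v\<in>supersolutions. v x < C" if "x \<in> A" for x
  proof -
    have "\<not> (\<forall>v\<in>supersolutions. C \<le> v x)"
      using unbdd A(2) that by (auto simp: bdd_below_def)
    then show ?thesis
      by (auto simp: not_le)
  qed
  then obtain v where v: "v \<in> supersolutions" "\<forall>x\<in>A. v x < C"
    using common_lower_supersolution[of A "\<lambda>_. C"] A(1) by blast
  \<comment> \<open>Inserting \<open>z\<close> makes \<open>a z\<close> occur in the sum even when
    \<open>v z = 0\<close>.\<close>
  define B where "B = insert z {x \<in> V. v x \<noteq> 0}"
  have B: "finite B" "B \<subseteq> V" "z \<in> B" "{x \<in> V. v x \<noteq> 0} \<subseteq> B"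
    using supersolutions_finite_support[OF v(1)] z by (auto simp: B_def)
  have "a z \<le> sum a (A \<union> B)"
    using A(1,2) B by (intro member_le_sum) (auto intro!: less_imp_le[OF a_pos])
  also have "\<dots> \<le> (\<Sum>x\<in>A \<union> B. b x * exp (v x))"
    using A(1,2) B by (intro sum_a_le_sum_b_exp v) auto
  also have "\<dots> = (\<Sum>x\<in>A. b x * exp (v x)) + (\<Sum>x\<in>B - A. b x * exp (v x))"
    using A(1,2) B sum.union_disjoint[of A "B - A" "\<lambda>x. b x * exp (v x)"] by simp
  also have "(\<Sum>x\<in>A. b x * exp (v x)) \<le> sum b A * exp C"
    unfolding sum_distrib_right using v A(2) b_pos
    by (intro sum_mono mult_left_mono) (auto intro: less_imp_le)
  also have "(\<Sum>x\<in>B - A. b x * exp (v x)) \<le> (\<Sum>x\<in>B - A. b x)"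
  proof (rule sum_mono)
    fix x assume "x \<in> B - A"
    then have "0 \<le> b x" "exp (v x) \<le> 1"
      using B b_pos[of x] supersolutions_nonpos[OF v(1)] by (auto intro: less_imp_le)
    then show "b x * exp (v x) \<le> b x"
      by (simp add: mult_left_le)
  qed
  also have "\<dots> < a z / 2"
    using A(3)[of "B - A"] B by auto
  finally show False
    using C by linarith
qed

section \<open>Spread of finiteness along edges\<close>

text \<open>The supersolution inequality at \<open>x\<close> bounds the weighted sum over the
  neighbours only from above. After the update at \<open>x\<close> it is an equality, and
  \<open>C \<le> t\<close> bounds that sum from below; all its terms are nonpositive, so the term of
  \<open>y\<close> alone obeys the same bound.\<close>

lemma bdd_below_neighbour:
  assumes edge: "{x, y} \<in> E" and bdd: "bdd_below ((\<lambda>v. v x) ` supersolutions)"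
  shows "bdd_below ((\<lambda>v. v y) ` supersolutions)"
proof -
  have xy: "x \<in> V" "y \<in> V" "0 < w x y"
    using edge edgeD weight_pos by auto
  obtain C where C: "\<And>v. v \<in> supersolutions \<Longrightarrow> C \<le> v x"
    using bdd by (auto simp: bdd_below_def)
  let ?W = "sum (w x) (nbhd x)"
  have W: "0 \<le> ?W"
    using weight_pos by (intro sum_nonneg) (auto intro: less_imp_le)
  have "(?W * C - a x) / w x y \<le> v y" if v: "v \<in> supersolutions" for v
  proof -
    obtain t where t: "v(x := t) \<in> supersolutions"
      "?W * t + b x * exp t = (\<Sum>y\<in>nbhd x. w x y * v y) + a x"
      using update_supersolution[OF v xy(1)] by blast
    have "?W * C \<le> ?W * t"
      using C[OF t(1)] W by (intro mult_left_mono) auto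
    moreover have "0 \<le> b x * exp t"
      using b_pos[OF xy(1)] by simp
    moreover have "(\<Sum>y\<in>nbhd x. w x y * v y) \<le> (\<Sum>y\<in>{y}. w x y * v y)"
    proof -
      have "w x z * v z \<le> 0" if "z \<in> nbhd x" for z
        using that weight_pos[of x z] supersolutions_nonpos[OF v, of z] edgeD[of x z]
        by (auto intro!: mult_nonneg_nonpos)
      then have "(\<Sum>z\<in>{y}. - (w x z * v z)) \<le> (\<Sum>z\<in>nbhd x. - (w x z * v z))"
        using edge finite_nbhd[OF xy(1)] by (intro sum_mono2) auto
      then show ?thesis
        by (simp add: sum_negf)
    qed
    ultimately have "?W * C - a x \<le> w x y * v y"
      using t(2) by simp
    then show ?thesis
      using xy by (simp add: field_simps)
  qed
  then show ?thesis
    by (auto simp: bdd_below_def)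
qed

lemma bdd_below_along_path:
  assumes "successively (\<lambda>x y. {x, y} \<in> E) p" "p \<noteq> []"
    "bdd_below ((\<lambda>v. v (hd p)) ` supersolutions)"
  shows "bdd_below ((\<lambda>v. v (last p)) ` supersolutions)"
  using assms
proof (induction p rule: induct_list012)
  case (3 x y p)
  then show ?case
    using bdd_below_neighbour[of x y] by simp
qed auto

lemma bdd_below_supersolutions:
  assumes "x \<in> V"
  shows "bdd_below ((\<lambda>v. v x) ` supersolutions)"
proof -
  obtain z where z: "z \<in> V" "bdd_below ((\<lambda>v. v z) ` supersolutions)"
    using bdd_below_some assms by blast
  obtain p where "path_joining V E z x p"
    using connected z assms by (auto simp: connected_graph_def)
  then show ?thesis
    using bdd_below_along_path[of p] z by (auto simp: path_joining_def)
qed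

section \<open>The infimum solves the equation\<close>

lemma solution_exists: "\<exists>u. \<forall>x\<in>V. flow u x = b x * exp (u x) - a x"
proof -
  define u where "u x = (INF v\<in>supersolutions. v x)" for x
  have u_le: "u x \<le> v x" if "v \<in> supersolutions" "x \<in> V" for v x
    unfolding u_def using that by (intro cINF_lower bdd_below_supersolutions)
  have less_u: "\<exists>v\<in>supersolutions. v x < c" if "x \<in> V" "u x < c" for x c
    using that bdd_below_supersolutions[of x] zero_supersolution
    by (subst (asm) u_def, subst (asm) cINF_less_iff) auto
  have "flow u x = b x * exp (u x) - a x" if x: "x \<in> V" for x
  proof -
    let ?W = "sum (w x) (nbhd x)" and ?s = "\<lambda>v. \<Sum>y\<in>nbhd x. w x y * v y"
    let ?\<phi> = "\<lambda>t. ?W * t + b x * exp t"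
    have W: "0 \<le> ?W"
      using weight_pos by (intro sum_nonneg) (auto intro: less_imp_le)
    have mono: "?\<phi> s \<le> ?\<phi> t" if "s \<le> t" for s t
      using that W b_pos[OF x] by (intro add_mono mult_left_mono) auto
    \<comment> \<open>The infimum need not be attained, so the inequality is shown for every
      \<open>t > u x\<close>, using a supersolution below \<open>t\<close> at \<open>x\<close>, and
      then \<open>t\<close> tends to \<open>u x\<close>.\<close>
    have "?s u + a x \<le> ?\<phi> (u x)"
    proof (rule tendsto_lowerbound)
      show "(?\<phi> \<longlongrightarrow> ?\<phi> (u x)) (at_right (u x))"
        by (auto intro!: tendsto_intros)
      have "?s u + a x \<le> ?\<phi> t" if "u x < t" for t
      proof -
        obtain v where v: "v \<in> supersolutions" "v x < t"
          using less_u[OF x \<open>u x < t\<close>] by blast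
        have "?s u \<le> ?s v"
          using v weight_pos u_le edgeD by (intro sum_mono mult_left_mono) (auto intro: less_imp_le)
        also have "?s v + a x \<le> ?\<phi> (v x)"
          using supersolutions_flow[OF v(1) x] by (simp add: flow_eq)
        also have "\<dots> \<le> ?\<phi> t"
          using v by (intro mono) simp
        finally show ?thesis
          by simp
      qed
      then show "\<forall>\<^sub>F t in at_right (u x). ?s u + a x \<le> ?\<phi> t"
        by (auto simp: eventually_at_filter)
    qed simp
    \<comment> \<open>For the converse, a single supersolution within \<open>e\<close> of
      \<open>u\<close> on the finite neighbourhood is updated at \<open>x\<close>; the new value
      still lies above \<open>u x\<close>. Then \<open>e\<close> tends to \<open>0\<close>.\<close>
    moreover have "?\<phi> (u x) \<le> ?s u + a x"
    proof (rule tendsto_lowerbound)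
      show "((\<lambda>e. ?s (\<lambda>y. u y + e) + a x) \<longlongrightarrow> ?s u + a x) (at_right 0)"
        by (auto intro!: tendsto_eq_intros)
      have "?\<phi> (u x) \<le> ?s (\<lambda>y. u y + e) + a x" if "0 < e" for e
      proof -
        have "\<exists>v\<in>supersolutions. v y < u y + e" if "y \<in> nbhd x" for y
          using that \<open>0 < e\<close> edgeD[of x y] by (intro less_u) auto
        then obtain v where v: "v \<in> supersolutions" "\<forall>y\<in>nbhd x. v y < u y + e"
          using common_lower_supersolution[OF finite_nbhd[OF x], of "\<lambda>y. u y + e"] by blast
        obtain t where t: "v(x := t) \<in> supersolutions" "?\<phi> t = ?s v + a x"
          using update_supersolution[OF v(1) x] by blast
        have "?\<phi> (u x) \<le> ?\<phi> t"
          using u_le[OF t(1) x] by (intro mono) simp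
        also note t(2)
        also have "?s v \<le> ?s (\<lambda>y. u y + e)"
          using v weight_pos by (intro sum_mono mult_left_mono) (auto intro: less_imp_le)
        finally show ?thesis
          by simp
      qed
      then show "\<forall>\<^sub>F e in at_right 0. ?\<phi> (u x) \<le> ?s (\<lambda>y. u y + e) + a x"
        by (auto simp: eventually_at_filter)
    qed simp
    ultimately show ?thesis
      by (simp add: flow_eq)
  qed
  then show ?thesis
    by blast
qed

end

section \<open>Return to the original equation\<close>

lemma (in weighted_graph) finite_neighbourhood:
  assumes "locally_finite_graph V E" "x \<in> V"
  shows "finite {y. {x, y} \<in> E}"
proof (rule finite_subset)
  \<comment> \<open>Balls are defined by a strict inequality, so radius \<open>2\<close> captures
    the vertices at distance \<open>1\<close>.\<close>
  show "finite (graph_ball V E x 2)"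
    using assms by (simp add: locally_finite_graph_def)
  show "{y. {x, y} \<in> E} \<subseteq> graph_ball V E x 2"
  proof
    fix y assume "y \<in> {y. {x, y} \<in> E}"
    then have edge: "{y, x} \<in> E"
      by (simp add: insert_commute)
    then have "x \<in> V" "y \<in> V"
      using edges by (force simp: doubleton_eq_iff)+
    then have "path_joining V E y x [y, x] \<and> length [y, x] - 1 = 1"
      using edge by (simp add: path_joining_def)
    then have "graph_dist V E y x \<le> 1"
      unfolding graph_dist_def by (intro Least_le) blast
    then show "y \<in> graph_ball V E x 2"
      using \<open>y \<in> V\<close> by (simp add: graph_ball_def)
  qed
qed

theorem theorem4:
  fixes V :: "'a set" and E :: "'a set set"
    and w :: "'a \<Rightarrow> 'a \<Rightarrow> real" and \<mu> :: "'a \<Rightarrow> real"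
    and f g :: "'a \<Rightarrow> real"
  assumes "weighted_graph V E w \<mu>"
    and "connected_graph V E"
    and "locally_finite_graph V E"
    and "\<And>x. x \<in> V \<Longrightarrow> g x \<le> f x \<and> f x < 0"
    and "g \<in> L1 V \<mu>"
  shows "\<exists>u :: 'a \<Rightarrow> real. \<forall>x\<in>V. laplacian E w \<mu> u x = f x - g x * exp (u x)"
proof -
  interpret weighted_graph V E w \<mu>
    by fact
  \<comment> \<open>As \<open>g\<close> is negative, its absolute value is \<open>- g\<close>; this
    form matches the summability in \<open>L1\<close> directly.\<close>
  interpret exponential_equation V E w \<mu> "\<lambda>x. - \<mu> x * f x" "\<lambda>x. \<mu> x * \<bar>g x\<bar>"
  proof
    show "0 < - \<mu> x * f x" if "x \<in> V" for x
      using assms(4)[OF that] measure_pos[OF that] by (simp add: mult_pos_neg)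
    show "- \<mu> x * f x \<le> \<mu> x * \<bar>g x\<bar>" if "x \<in> V" for x
      using assms(4)[OF that] measure_pos[OF that] mult_left_mono[of "- f x" "\<bar>g x\<bar>" "\<mu> x"]
      by simp
    show "(\<lambda>x. \<mu> x * \<bar>g x\<bar>) summable_on V"
      using assms(5) by (simp add: L1_def)
  qed (use assms finite_neighbourhood in auto)
  obtain u where u: "\<forall>x\<in>V. flow u x = \<mu> x * \<bar>g x\<bar> * exp (u x) - - \<mu> x * f x"
    using solution_exists by blast
  have "laplacian E w \<mu> u x = f x - g x * exp (u x)" if x: "x \<in> V" for x
  proof -
    have "laplacian E w \<mu> u x = flow u x / \<mu> x"
      by (simp add: laplacian_def flow_def)
    also have "\<dots> = f x + \<bar>g x\<bar> * exp (u x)"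
      using u x measure_pos[OF x] by (simp add: field_simps)
    also have "\<bar>g x\<bar> = - g x"
      using assms(4)[OF x] by simp
    finally show ?thesis
      by simp
  qed
  then show ?thesis
    by blast
qed

end
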